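(* Let $A$ be an associative conformal algebra, $Q$ a $\mathbb{C}[\partial]$-module and $E=A\oplus Q$ the direct sum of $\mathbb{C}[\partial]$-modules. Suppose that $E$ has an associative conformal algebra structure $\cdot_\lambda\cdot$ such that $A$ is a subalgebra. Then there exist an associative conformal extending structure $\Omega(A,Q)=(\leftharpoonup_\lambda,\rightharpoonup_\lambda,\lhd_\lambda,\rhd_\lambda,f_\lambda,\circ_\lambda)$ of $A$ by $Q$ and an isomorphism of associative conformal algebras $E\approx A\natural Q$, i.e. an isomorphism which stabilizes $A$ and co-stabilizes $Q$.
   Context: An associative conformal algebra is a $\mathbb{C}[\partial]$-module $A$ with a $\mathbb{C}$-bilinear $\lambda$-product $A\times A\to A[\lambda]$, $(a,b)\mapsto a_\lambda b$, such that $(\partial a)_\lambda b=-\lambda a_\lambda b$, $a_\lambda\partial b=(\lambda+\partial)a_\lambda b$ and $a_\lambda(b_\mu c)=(a_\lambda b)_{\lambda+\mu}c$. All maps are extended coefficientwise to polynomials in $\lambda,\mu$. Homomorphisms and subalgebras are defined as usual. A conformal bilinear map $f_\lambda:U\times V\to W[\lambda]$ between $\mathbb{C}[\partial]$-modules is a $\mathbb{C}$-bilinear map with $f_\lambda(\partial u,v)=-\lambda f_\lambda(u,v)$, $f_\lambda(u,\partial v)=(\partial+\lambda)f_\lambda(u,v)$. An extending datum of $A$ by $Q$ is a system $\Omega(A,Q)=(\leftharpoonup_\lambda,\rightharpoonup_\lambda,\lhd_\lambda,\rhd_\lambda,f_\lambda,\circ_\lambda)$ of six conformal bilinear maps $\leftharpoonup_\lambda:A\times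 Q\to A[\lambda]$, $\rightharpoonup_\lambda:A\times Q\to Q[\lambda]$, $\lhd_\lambda:Q\times A\to Q[\lambda]$, $\rhd_\lambda:Q\times A\to A[\lambda]$, $f_\lambda:Q\times Q\to A[\lambda]$, $\circ_\lambda:Q\times Q\to Q[\lambda]$. On the $\mathbb{C}[\partial]$-module $A\times Q$ it defines the $\lambda$-product $$(a,x)_\lambda(b,y)=(a_\lambda b+a\leftharpoonup_\lambda y+x\rhd_\lambda b+f_\lambda(x,y),\ a\rightharpoonup_\lambda y+x\lhd_\lambda b+x\circ_\lambda y).$$ If this makes $A\times Q$ an associative conformal algebra, it is called the unified product $A\natural Q$ and $\Omega(A,Q)$ is called an associative conformal extending structure of $A$ by $Q$. A $\mathbb{C}[\partial]$-module homomorphism $\varphi$ from $A\oplus Q$ to $A\times Q$ (the two being identified as $\mathbb{C}[\partial]$-modules) stabilizes $A$ if $\varphi(a)=(a,0)$ for all $a\in A$, and co-stabilizes $Q$ if it commutes with the natural projections onto $Q$. The symbol $\approx$ between two algebra structures means that there is an isomorphism between them stabilizing $A$ and co-stabilizing $Q$. *)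

theory Defs
  imports
    "HOL-Computational_Algebra.Polynomial"
    "HOL-Analysis.Product_Vector"
begin

text \<open>
  A \<open>\<complex>[\<partial>]\<close>-module is a type \<^typ>\<open>'a::ab_group_add\<close> with an action \<open>s\<close> of \<^typ>\<open>complex poly\<close>
  such that \<^term>\<open>module s\<close>.  The indeterminate acts as \<open>\<partial>\<close>, the constant polynomials as the
  complex scalars.  The space \<open>W[\<lambda>]\<close> is \<open>'w poly\<close>, and \<open>W[\<lambda>, \<mu>]\<close> is \<open>'w poly poly\<close>,
  where the outer variable is \<open>\<mu>\<close> and the inner one is \<open>\<lambda>\<close>.
\<close>

definition partial :: "(complex poly \<Rightarrow> 'a \<Rightarrow> 'a) \<Rightarrow> 'a \<Rightarrow> 'a"
  where "partial s = s [:0, 1:]"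

definition cscale :: "(complex poly \<Rightarrow> 'a \<Rightarrow> 'a) \<Rightarrow> complex \<Rightarrow> 'a \<Rightarrow> 'a"
  where "cscale s k = s [:k:]"

text \<open>
  Multiplication by \<open>\<lambda>\<close> is \<^term>\<open>pCons 0\<close> on \<open>W[\<lambda>]\<close>.
\<close>

locale conformal_bilinear =
  U: module sU + V: module sV + W: module sW
  for sU :: "complex poly \<Rightarrow> 'u::ab_group_add \<Rightarrow> 'u"
  and sV :: "complex poly \<Rightarrow> 'v::ab_group_add \<Rightarrow> 'v"
  and sW :: "complex poly \<Rightarrow> 'w::ab_group_add \<Rightarrow> 'w" +
  fixes f :: "'u \<Rightarrow> 'v \<Rightarrow> 'w poly"
  assumes linear_left:
      "Vector_Spaces.linear (cscale sU) (\<lambda>k. map_poly (cscale sW k)) (\<lambda>u. f u v)"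
    and linear_right:
      "Vector_Spaces.linear (cscale sV) (\<lambda>k. map_poly (cscale sW k)) (\<lambda>v. f u v)"
    and partial_left: "f (partial sU u) v = - pCons 0 (f u v)"
    and partial_right: "f u (partial sV v) = map_poly (partial sW) (f u v) + pCons 0 (f u v)"

text \<open>
  \<open>mult_lambda\<close> and \<open>mult_lambda_plus_mu\<close> are the multiplications by \<open>\<lambda>\<close> and \<open>\<lambda> + \<mu>\<close> on \<open>W[\<lambda>, \<mu>]\<close>;
  \<open>at_lambda_plus_mu p\<close> is \<open>p(\<lambda> + \<mu>)\<close> for \<open>p(\<lambda>) \<in> W[\<lambda>]\<close>.
\<close>

definition mult_lambda :: "'w::comm_monoid_add poly poly \<Rightarrow> 'w poly poly"
  where "mult_lambda F = map_poly (pCons 0) F"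

definition mult_lambda_plus_mu :: "'w::comm_monoid_add poly poly \<Rightarrow> 'w poly poly"
  where "mult_lambda_plus_mu F = mult_lambda F + pCons 0 F"

definition at_lambda_plus_mu :: "'w::comm_monoid_add poly \<Rightarrow> 'w poly poly"
  where "at_lambda_plus_mu p = (\<Sum>k\<le>degree p. (mult_lambda_plus_mu ^^ k) [:[:coeff p k:]:])"

text \<open>
  With \<open>b\<^sub>\<mu> c = \<Sum>\<^sub>n \<mu>\<^sup>n d\<^sub>n\<close> and \<open>a\<^sub>\<lambda> b = \<Sum>\<^sub>m \<lambda>\<^sup>m e\<^sub>m\<close>, the two sides of conformal
  associativity are \<open>\<Sum>\<^sub>n \<mu>\<^sup>n (a\<^sub>\<lambda> d\<^sub>n)\<close> and \<open>\<Sum>\<^sub>m \<lambda>\<^sup>m ((e\<^sub>m)\<^sub>\<lambda>\<^sub>+\<^sub>\<mu> c)\<close>.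
\<close>

definition assoc_left :: "('a::ab_group_add \<Rightarrow> 'a \<Rightarrow> 'a poly) \<Rightarrow> 'a \<Rightarrow> 'a \<Rightarrow> 'a \<Rightarrow> 'a poly poly"
  where "assoc_left lp a b c = map_poly (lp a) (lp b c)"

definition assoc_right :: "('a::ab_group_add \<Rightarrow> 'a \<Rightarrow> 'a poly) \<Rightarrow> 'a \<Rightarrow> 'a \<Rightarrow> 'a \<Rightarrow> 'a poly poly"
  where "assoc_right lp a b c =
    (\<Sum>m\<le>degree (lp a b). (mult_lambda ^^ m) (at_lambda_plus_mu (lp (coeff (lp a b) m) c)))"

locale assoc_conformal_algebra = conformal_bilinear s s s lp
  for s :: "complex poly \<Rightarrow> 'a::ab_group_add \<Rightarrow> 'a"
  and lp :: "'a \<Rightarrow> 'a \<Rightarrow> 'a poly" +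
  assumes conformal_assoc: "assoc_left lp a b c = assoc_right lp a b c"

locale assoc_conformal_hom =
  A: assoc_conformal_algebra sA lpA + B: assoc_conformal_algebra sB lpB +
  module_hom sA sB \<phi>
  for sA :: "complex poly \<Rightarrow> 'a::ab_group_add \<Rightarrow> 'a" and lpA :: "'a \<Rightarrow> 'a \<Rightarrow> 'a poly"
  and sB :: "complex poly \<Rightarrow> 'b::ab_group_add \<Rightarrow> 'b" and lpB :: "'b \<Rightarrow> 'b \<Rightarrow> 'b poly"
  and \<phi> :: "'a \<Rightarrow> 'b" +
  assumes hom_lambda: "map_poly \<phi> (lpA a b) = lpB (\<phi> a) (\<phi> b)"

locale assoc_conformal_iso = assoc_conformal_hom +
  assumes bij: "bij \<phi>"

text \<open>
  \<open>A\<close>, with its own structure, is a subalgebra of \<open>B\<close> via the inclusion \<open>\<iota>\<close>.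
\<close>

locale conformal_subalgebra = assoc_conformal_hom sA lpA sB lpB \<iota>
  for sA :: "complex poly \<Rightarrow> 'a::ab_group_add \<Rightarrow> 'a" and lpA :: "'a \<Rightarrow> 'a \<Rightarrow> 'a poly"
  and sB :: "complex poly \<Rightarrow> 'b::ab_group_add \<Rightarrow> 'b" and lpB :: "'b \<Rightarrow> 'b \<Rightarrow> 'b poly"
  and \<iota> :: "'a \<Rightarrow> 'b" +
  assumes inj: "inj \<iota>"

text \<open>
  The six maps are \<open>\<leftharpoonup>\<close>, \<open>\<rightharpoonup>\<close>, \<open>\<lhd>\<close>, \<open>\<rhd>\<close>, \<open>f\<close>, \<open>\<circ>\<close>, in this order.
\<close>

record (overloaded) ('a, 'q) ext_datum =
  lharp :: "'a \<Rightarrow> 'q \<Rightarrow> 'a poly"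
  rharp :: "'a \<Rightarrow> 'q \<Rightarrow> 'q poly"
  ltri :: "'q \<Rightarrow> 'a \<Rightarrow> 'q poly"
  rtri :: "'q \<Rightarrow> 'a \<Rightarrow> 'a poly"
  cocycle :: "'q \<Rightarrow> 'q \<Rightarrow> 'a poly"
  circ :: "'q \<Rightarrow> 'q \<Rightarrow> 'q poly"

definition extending_datum ::
    "(complex poly \<Rightarrow> 'a::ab_group_add \<Rightarrow> 'a) \<Rightarrow> (complex poly \<Rightarrow> 'q::ab_group_add \<Rightarrow> 'q)
      \<Rightarrow> ('a, 'q) ext_datum \<Rightarrow> bool"
  where "extending_datum sA sQ \<Omega> \<longleftrightarrow>
    conformal_bilinear sA sQ sA (lharp \<Omega>) \<and>
    conformal_bilinear sA sQ sQ (rharp \<Omega>) \<and>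
    conformal_bilinear sQ sA sQ (ltri \<Omega>) \<and>
    conformal_bilinear sQ sA sA (rtri \<Omega>) \<and>
    conformal_bilinear sQ sQ sA (cocycle \<Omega>) \<and>
    conformal_bilinear sQ sQ sQ (circ \<Omega>)"

text \<open>
  The identification \<open>A[\<lambda>] \<times> Q[\<lambda>] = (A \<times> Q)[\<lambda>]\<close>.
\<close>

definition poly_pair :: "'a::ab_group_add poly \<Rightarrow> 'q::ab_group_add poly \<Rightarrow> ('a \<times> 'q) poly"
  where "poly_pair p q = map_poly (\<lambda>a. (a, 0)) p + map_poly (\<lambda>x. (0, x)) q"

definition unified_product ::
    "('a::ab_group_add \<Rightarrow> 'a \<Rightarrow> 'a poly) \<Rightarrow> ('a, 'q::ab_group_add) ext_datum
      \<Rightarrow> 'a \<times> 'q \<Rightarrow> 'a \<times> 'q \<Rightarrow> ('a \<times> 'q) poly"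
  where "unified_product lpA \<Omega> = (\<lambda>(a, x) (b, y).
    poly_pair
      (lpA a b + lharp \<Omega> a y + rtri \<Omega> x b + cocycle \<Omega> x y)
      (rharp \<Omega> a y + ltri \<Omega> x b + circ \<Omega> x y))"

definition extending_structure ::
    "(complex poly \<Rightarrow> 'a::ab_group_add \<Rightarrow> 'a) \<Rightarrow> ('a \<Rightarrow> 'a \<Rightarrow> 'a poly)
      \<Rightarrow> (complex poly \<Rightarrow> 'q::ab_group_add \<Rightarrow> 'q) \<Rightarrow> ('a, 'q) ext_datum \<Rightarrow> bool"
  where "extending_structure sA lpA sQ \<Omega> \<longleftrightarrow>
    extending_datum sA sQ \<Omega> \<and>
    assoc_conformal_algebra (module_prod.scale sA sQ) (unified_product lpA \<Omega>)"

definition stabilizes :: "('a \<times> 'q::zero \<Rightarrow> 'a \<times> 'q) \<Rightarrow> bool"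
  where "stabilizes \<phi> \<longleftrightarrow> (\<forall>a. \<phi> (a, 0) = (a, 0))"

definition co_stabilizes :: "('a \<times> 'q \<Rightarrow> 'a \<times> 'q) \<Rightarrow> bool"
  where "co_stabilizes \<phi> \<longleftrightarrow> snd \<circ> \<phi> = snd"

text \<open>
  The relation \<open>\<approx>\<close> between two algebra structures on the module \<open>A \<oplus> Q = A \<times> Q\<close>.
\<close>

definition ext_iso ::
    "(complex poly \<Rightarrow> 'a::ab_group_add \<Rightarrow> 'a) \<Rightarrow> (complex poly \<Rightarrow> 'q::ab_group_add \<Rightarrow> 'q)
      \<Rightarrow> ('a \<times> 'q \<Rightarrow> 'a \<times> 'q \<Rightarrow> ('a \<times> 'q) poly) \<Rightarrow> ('a \<times> 'q \<Rightarrow> 'a \<times> 'q \<Rightarrow> ('a \<times> 'q) poly) \<Rightarrow> bool"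
  where "ext_iso sA sQ lp lp' \<longleftrightarrow>
    (\<exists>\<phi>. assoc_conformal_iso (module_prod.scale sA sQ) lp (module_prod.scale sA sQ) lp' \<phi> \<and>
      stabilizes \<phi> \<and> co_stabilizes \<phi>)"

end

theory Submission
  imports Defs
begin

text \<open>Every element of \<open>E\<close> is \<open>(a, 0) + (0, x)\<close>, so biadditivity
  splits the product of two elements into four products of elements from the summands. The one
  within \<open>A\<close> is \<open>lpA\<close>, since \<open>A\<close> is a subalgebra; the other
  three have a component in \<open>A\<close> and one in \<open>Q\<close>, and these six components
  are the maps of the datum. Each is \<open>lpE\<close> restricted along inclusions and followed by
  a projection, all linear over the polynomial ring, so \<open>conformal_bilinear_compose\<close>
  makes it conformal bilinear. The unified product is then \<open>lpE\<close> itself: associativity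
  is inherited and the identity is the required isomorphism.\<close>

lemma module_imp_vector_space:
  assumes "module s"
  shows "vector_space (cscale s)"
proof -
  interpret module s by fact
  show ?thesis
    by unfold_locales
      (simp_all add: cscale_def scale_right_distrib mult.commute flip: scale_left_distrib one_pCons)
qed

text \<open>\<open>Vector_Spaces.linear\<close> includes the vector space axioms for source and
  target, and the target of a conformal bilinear map is a polynomial space.\<close>

lemma module_imp_vector_space_map_poly:
  assumes "module s"
  shows "vector_space (\<lambda>k. map_poly (cscale s k))"
proof -
  interpret vector_space "cscale s"
    by (rule module_imp_vector_space) fact
  show ?thesis
    by unfold_locales
      (simp_all add: poly_eq_iff coeff_map_poly scale_right_distrib scale_left_distrib)
qed

context conformal_bilinear
begin

lemma add_left: "f (u + u') v = f u v + f u' v"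
  using linear_left by (simp add: Vector_Spaces.linear_iff)

lemma add_right: "f u (v + v') = f u v + f u v'"
  using linear_right by (simp add: Vector_Spaces.linear_iff)

lemma cscale_left: "f (cscale sU k u) v = map_poly (cscale sW k) (f u v)"
  using linear_left by (simp add: Vector_Spaces.linear_iff)

lemma cscale_right: "f u (cscale sV k v) = map_poly (cscale sW k) (f u v)"
  using linear_right by (simp add: Vector_Spaces.linear_iff)

text \<open>Module homomorphisms commute with the complex scalars and with \<open>partial\<close>;
  applied coefficientwise they also commute with multiplication by \<lambda>. Hence each axiom
  survives composition.\<close>

lemma conformal_bilinear_compose:
  assumes g: "module_hom sU' sU g" and h: "module_hom sV' sV h" and p: "module_hom sW sW' p"
  shows "conformal_bilinear sU' sV' sW' (\<lambda>u v. map_poly p (f (g u) (h v)))"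
proof -
  interpret g: module_hom sU' sU g by fact
  interpret h: module_hom sV' sV h by fact
  interpret p: module_hom sW sW' p by fact
  have g_cscale: "g (cscale sU' k u) = cscale sU k (g u)" for k u
    by (simp add: cscale_def g.scale)
  have h_cscale: "h (cscale sV' k v) = cscale sV k (h v)" for k v
    by (simp add: cscale_def h.scale)
  have p_cscale: "p (cscale sW k w) = cscale sW' k (p w)" for k w
    by (simp add: cscale_def p.scale)
  \<comment> \<open>\<open>coeff_map_poly\<close> applies only to maps that send 0 to 0.\<close>
  have scale_0: "cscale sW k 0 = 0" "cscale sW' k 0 = 0" "partial sW 0 = 0" "partial sW' 0 = 0" for k
    by (simp_all add: cscale_def partial_def)
  show ?thesis
  proof (intro conformal_bilinear.intro conformal_bilinear_axioms.intro
      g.m1.module_axioms h.m1.module_axioms p.m2.module_axioms)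
    show "Vector_Spaces.linear (cscale sU') (\<lambda>k. map_poly (cscale sW' k)) (\<lambda>u. map_poly p (f (g u) (h v)))" for v
      unfolding Vector_Spaces.linear_iff
      by (auto simp: g.m1.module_axioms p.m2.module_axioms module_imp_vector_space
          module_imp_vector_space_map_poly g.add g_cscale add_left cscale_left
          poly_eq_iff coeff_map_poly p.add scale_0 p_cscale)
    show "Vector_Spaces.linear (cscale sV') (\<lambda>k. map_poly (cscale sW' k)) (\<lambda>v. map_poly p (f (g u) (h v)))" for u
      unfolding Vector_Spaces.linear_iff
      by (auto simp: h.m1.module_axioms p.m2.module_axioms module_imp_vector_space
          module_imp_vector_space_map_poly h.add h_cscale add_right cscale_right
          poly_eq_iff coeff_map_poly p.add scale_0 p_cscale)
    show "map_poly p (f (g (partial sU' u)) (h v)) = - pCons 0 (map_poly p (f (g u) (h v)))" for u v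
      using partial_left[of "g u" "h v"]
      by (simp add: partial_def g.scale poly_eq_iff coeff_map_poly coeff_pCons p.neg split: nat.split)
    show "map_poly p (f (g u) (h (partial sV' v))) =
        map_poly (partial sW') (map_poly p (f (g u) (h v))) + pCons 0 (map_poly p (f (g u) (h v)))" for u v
      using partial_right[of "g u" "h v"]
      by (simp add: partial_def h.scale poly_eq_iff coeff_map_poly coeff_pCons p.add p.scale
          split: nat.split)
  qed
qed

end

text \<open>Reassembles a product of \<open>lpE\<close> from the two components that the datum
  stores separately.\<close>

lemma poly_pair_map_poly: "poly_pair (map_poly fst p) (map_poly snd p) = p"
  by (simp add: poly_pair_def poly_eq_iff coeff_map_poly zero_prod_def)

lemma poly_pair_add: "poly_pair (p + p') (q + q') = poly_pair p q + poly_pair p' q'"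
  by (simp add: poly_pair_def poly_eq_iff coeff_map_poly zero_prod_def)

theorem theorem3p4:
  fixes sA :: "complex poly \<Rightarrow> 'a::ab_group_add \<Rightarrow> 'a"
    and lpA :: "'a \<Rightarrow> 'a \<Rightarrow> 'a poly"
    and sQ :: "complex poly \<Rightarrow> 'q::ab_group_add \<Rightarrow> 'q"
    and lpE :: "'a \<times> 'q \<Rightarrow> 'a \<times> 'q \<Rightarrow> ('a \<times> 'q) poly"
  assumes "assoc_conformal_algebra sA lpA"
    and "module sQ"
    and "assoc_conformal_algebra (module_prod.scale sA sQ) lpE"
    and "conformal_subalgebra sA lpA (module_prod.scale sA sQ) lpE (\<lambda>a. (a, 0))"
  shows "\<exists>\<Omega> :: ('a, 'q) ext_datum.
    extending_structure sA lpA sQ \<Omega> \<and>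
    ext_iso sA sQ lpE (unified_product lpA \<Omega>)"
proof -
  interpret A: assoc_conformal_algebra sA lpA by fact
  interpret Q: module sQ by fact
  interpret prod: module_prod sA sQ ..
  let ?sE = "module_prod.scale sA sQ"
  interpret E: assoc_conformal_algebra ?sE lpE by fact
  interpret sub: conformal_subalgebra sA lpA ?sE lpE "\<lambda>a. (a, 0)" by fact
  let ?inA = "\<lambda>a::'a. (a, 0::'q)" and ?inQ = "\<lambda>x::'q. (0::'a, x)"
  have homs: "module_hom sA ?sE ?inA" "module_hom sQ ?sE ?inQ"
    "module_hom ?sE sA fst" "module_hom ?sE sQ snd"
    by (unfold_locales; auto simp: prod.scale_def)+
  \<comment> \<open>The components of the three products that involve \<open>Q\<close>: two from A
    times Q, two from Q times A, two from Q times Q.\<close>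
  define \<Omega> :: "('a, 'q) ext_datum" where "\<Omega> =
    \<lparr>lharp = \<lambda>a y. map_poly fst (lpE (?inA a) (?inQ y)),
     rharp = \<lambda>a y. map_poly snd (lpE (?inA a) (?inQ y)),
     ltri = \<lambda>x b. map_poly snd (lpE (?inQ x) (?inA b)),
     rtri = \<lambda>x b. map_poly fst (lpE (?inQ x) (?inA b)),
     cocycle = \<lambda>x y. map_poly fst (lpE (?inQ x) (?inQ y)),
     circ = \<lambda>x y. map_poly snd (lpE (?inQ x) (?inQ y))\<rparr>"
  have datum: "extending_datum sA sQ \<Omega>"
    unfolding extending_datum_def \<Omega>_def ext_datum.simps
    by (intro conjI E.conformal_bilinear_compose homs)
  have "unified_product lpA \<Omega> (a, x) (b, y) = lpE (a, x) (b, y)" for a x b y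
  proof -
    have "lpE (a, x) (b, y) = lpE (?inA a + ?inQ x) (?inA b + ?inQ y)"
      by simp
    also have "\<dots> = lpE (?inA a) (?inA b) + lpE (?inA a) (?inQ y)
        + lpE (?inQ x) (?inA b) + lpE (?inQ x) (?inQ y)"
      by (simp only: E.add_left E.add_right add_ac)
    \<comment> \<open>The subalgebra hypothesis enters here: this product has no \<open>Q\<close>
      component.\<close>
    also have "lpE (?inA a) (?inA b) = poly_pair (lpA a b) 0"
      by (simp add: poly_pair_def flip: sub.hom_lambda)
    \<comment> \<open>The \<open>A\<close> component has four summands and the \<open>Q\<close>
      component three; the instance of \<open>poly_pair_add\<close> with \<open>q = 0\<close> splits
      off the unmatched \<open>lpA a b\<close>.\<close>
    also have "poly_pair (lpA a b) 0 + lpE (?inA a) (?inQ y) + lpE (?inQ x) (?inA b)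
        + lpE (?inQ x) (?inQ y) = unified_product lpA \<Omega> (a, x) (b, y)"
      by (simp add: unified_product_def \<Omega>_def poly_pair_add poly_pair_map_poly
          poly_pair_add[where p = "lpA a b" and q = 0, simplified])
    finally show ?thesis ..
  qed
  then have unified: "unified_product lpA \<Omega> = lpE"
    by (simp add: fun_eq_iff)
  have "assoc_conformal_iso ?sE lpE ?sE lpE id"
    by unfold_locales (simp_all add: map_poly_id)
  then have "ext_iso sA sQ lpE lpE"
    unfolding ext_iso_def by (intro exI[of _ id]) (simp add: stabilizes_def co_stabilizes_def)
  then show ?thesis
    using datum E.assoc_conformal_algebra_axioms
    by (intro exI[of _ \<Omega>]) (simp add: extending_structure_def unified)
qed

end
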